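(* Let $\alpha_1,\alpha_2,\beta_1,\beta_2,\gamma>-1$ be real numbers with $(\alpha_1,\beta_1)\ne(\alpha_2,\beta_2)$, and let $0\le k_1\le n_1$, $0\le k_2\le n_2$ be integers. Then the polynomial $A_{\vec n,\vec k}=U^{(\vec\alpha,\vec\beta,\gamma)}_{\vec n,\vec k}=D_2\circ D_1[(1-x-y)^{n_1+n_2}]$ is a solution of the following Hermite--Padé-type problem: $A_{\vec n,\vec k}$ is a polynomial of total degree at most $n_1+n_2$ and, with $$\Phi^{(j)}_{\vec n,\vec k}(z,w)=\int_T\frac{A_{\vec n,\vec k}(z,w)-A_{\vec n,\vec k}(x,y)}{(z-x)(w-y)}\,W_j(x,y)\,dx\,dy,$$ one has $$A_{\vec n,\vec k}(z,w)\,E_j(z,w)=\Phi^{(j)}_{\vec n,\vec k}(z,w)+\mathcal O\big(z^{-(n_j-k_j)-1}w^{-k_j-1}\big),\qquad z,w\to\infty,\quad j=1,2.$$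
   Context: Let $T=\{(x,y)\in\mathbb R^2: x\ge 0,\ y\ge 0,\ x+y\le 1\}$, $W_j(x,y)=x^{\alpha_j}y^{\beta_j}(1-x-y)^{\gamma}$ for $j=1,2$, and $$E_j(z,w)=\int_T\frac{W_j(x,y)\,dx\,dy}{(z-x)(w-y)},\qquad j=1,2,$$ for sufficiently large $|z|,|w|$. The operators are $$D_j[f(x,y)]=\frac{1}{W_j(x,y)}\,\frac{\partial^{n_j}}{\partial x^{n_j-k_j}\,\partial y^{k_j}}\Big(W_j(x,y)\,x^{n_j-k_j}y^{k_j}f(x,y)\Big),\qquad j=1,2,$$ taken on the interior of $T$, and $D_2\circ D_1[(1-x-y)^{n_1+n_2}]$ coincides there with a polynomial, denoted $U^{(\vec\alpha,\vec\beta,\gamma)}_{\vec n,\vec k}$, where $\vec n=(n_1,n_2)$, $\vec k=(k_1,k_2)$, $\vec\alpha=(\alpha_1,\alpha_2)$, $\vec\beta=(\beta_1,\beta_2)$. Meaning of the $\mathcal O$ condition: for sufficiently large $|z|,|w|$ the remainder $A_{\vec n,\vec k}E_j-\Phi^{(j)}_{\vec n,\vec k}$ has a double Laurent expansion $\sum_{l\ge 0}\sum_{m\ge 0} b^{(j)}_{l,m}z^{-l-1}w^{-m-1}$, and the condition $\mathcal O(z^{-(n_j-k_j)-1}w^{-k_j-1})$ means that $b^{(j)}_{l,m}=0$ for all $(l,m)\in\mathbb N_0^2$ with $l<n_j-k_j$ or $m<k_j$. *)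

theory Defs
  imports "HOL-Analysis.Analysis" "HOL-Computational_Algebra.Polynomial"
begin

definition std_triangle :: "(real \<times> real) set" where
  "std_triangle = {(x, y). x \<ge> 0 \<and> y \<ge> 0 \<and> x + y \<le> 1}"

definition weight :: "real \<Rightarrow> real \<Rightarrow> real \<Rightarrow> real \<Rightarrow> real \<Rightarrow> real" where
  "weight \<alpha> \<beta> \<gamma> x y = x powr \<alpha> * y powr \<beta> * (1 - x - y) powr \<gamma>"

text \<open>
  A polynomial in \<open>x\<close> and \<open>y\<close> is a \<open>real poly poly\<close> whose outer variable is \<open>y\<close>:
  the coefficient of \<open>x\<^sup>i y\<^sup>j\<close> in \<open>p\<close> is \<open>coeff (coeff p j) i\<close>.
  The target type of the evaluation is generic, since the same real polynomial is
  evaluated both at real and at complex points.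
\<close>

definition eval2 :: "real poly poly \<Rightarrow> 'a::real_field \<Rightarrow> 'a \<Rightarrow> 'a" where
  "eval2 p x y = poly (map_poly (\<lambda>q. poly (map_poly of_real q) x) p) y"

definition total_degree_le :: "'a::zero poly poly \<Rightarrow> nat \<Rightarrow> bool" where
  "total_degree_le p N \<longleftrightarrow> (\<forall>i j. coeff (coeff p j) i \<noteq> 0 \<longrightarrow> i + j \<le> N)"

definition mixed_partial ::
    "nat \<Rightarrow> nat \<Rightarrow> (real \<Rightarrow> real \<Rightarrow> real) \<Rightarrow> real \<Rightarrow> real \<Rightarrow> real" where
  "mixed_partial a b F x y = (deriv ^^ a) (\<lambda>s. (deriv ^^ b) (\<lambda>t. F s t) y) x"

text \<open>
  The following operator is meaningful only at interior points of the triangle.  The value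
  there depends only on the values of \<open>f\<close> near the point, so composing two such operators
  is unaffected by the values outside the interior.
\<close>

definition rodrigues_op ::
    "real \<Rightarrow> real \<Rightarrow> real \<Rightarrow> nat \<Rightarrow> nat \<Rightarrow> (real \<Rightarrow> real \<Rightarrow> real) \<Rightarrow> real \<Rightarrow> real \<Rightarrow> real" where
  "rodrigues_op \<alpha> \<beta> \<gamma> n k f x y =
     1 / weight \<alpha> \<beta> \<gamma> x y *
     mixed_partial (n - k) k (\<lambda>x y. weight \<alpha> \<beta> \<gamma> x y * x ^ (n - k) * y ^ k * f x y) x y"

text \<open>
  From here on the parameter vectors are functions on \<open>nat\<close>, of which only the
  components \<open>1\<close> and \<open>2\<close> are used.
\<close>

definition rodrigues_fun ::
    "(nat \<Rightarrow> real) \<Rightarrow> (nat \<Rightarrow> real) \<Rightarrow> real \<Rightarrow> (nat \<Rightarrow> nat) \<Rightarrow> (nat \<Rightarrow> nat) \<Rightarrow> real \<Rightarrow> real \<Rightarrow> real" where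
  "rodrigues_fun \<alpha> \<beta> \<gamma> n k =
     (rodrigues_op (\<alpha> 2) (\<beta> 2) \<gamma> (n 2) (k 2) \<circ> rodrigues_op (\<alpha> 1) (\<beta> 1) \<gamma> (n 1) (k 1))
       (\<lambda>x y. (1 - x - y) ^ (n 1 + n 2))"

definition U_poly ::
    "(nat \<Rightarrow> real) \<Rightarrow> (nat \<Rightarrow> real) \<Rightarrow> real \<Rightarrow> (nat \<Rightarrow> nat) \<Rightarrow> (nat \<Rightarrow> nat) \<Rightarrow> real poly poly" where
  "U_poly \<alpha> \<beta> \<gamma> n k =
     (THE p. \<forall>(x, y) \<in> interior std_triangle. eval2 p x y = rodrigues_fun \<alpha> \<beta> \<gamma> n k x y)"

definition stieltjes :: "real \<Rightarrow> real \<Rightarrow> real \<Rightarrow> complex \<Rightarrow> complex \<Rightarrow> complex" where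
  "stieltjes \<alpha> \<beta> \<gamma> z w =
     (LINT (x, y):std_triangle|lborel.
        of_real (weight \<alpha> \<beta> \<gamma> x y) / ((z - of_real x) * (w - of_real y)))"

definition phi_fun ::
    "real poly poly \<Rightarrow> real \<Rightarrow> real \<Rightarrow> real \<Rightarrow> complex \<Rightarrow> complex \<Rightarrow> complex" where
  "phi_fun A \<alpha> \<beta> \<gamma> z w =
     (LINT (x, y):std_triangle|lborel.
        (eval2 A z w - of_real (eval2 A x y)) / ((z - of_real x) * (w - of_real y))
          * of_real (weight \<alpha> \<beta> \<gamma> x y))"

text \<open>
  \<open>bigO_laurent f p q\<close> renders \<open>f = O(z\<^bsup>-p-1\<^esup> w\<^bsup>-q-1\<^esup>)\<close>: for sufficiently large \<open>|z|\<close>, \<open>|w|\<close>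
  the function \<open>f\<close> is the sum of a double Laurent series in which every coefficient of
  \<open>z\<^bsup>-l-1\<^esup> w\<^bsup>-m-1\<^esup>\<close> with \<open>l < p\<close> or \<open>m < q\<close> (not just with both) vanishes.
\<close>

definition bigO_laurent :: "(complex \<Rightarrow> complex \<Rightarrow> complex) \<Rightarrow> nat \<Rightarrow> nat \<Rightarrow> bool" where
  "bigO_laurent f p q \<longleftrightarrow>
     (\<exists>b :: nat \<Rightarrow> nat \<Rightarrow> complex.
        (\<forall>\<^sub>F (z, w) in at_infinity \<times>\<^sub>F at_infinity.
           ((\<lambda>(l, m). b l m / (z ^ (l + 1) * w ^ (m + 1))) has_sum f z w) UNIV) \<and>
        (\<forall>l m. l < p \<or> m < q \<longrightarrow> b l m = 0))"

end

theory Submission imports Defs begin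

text \<open>
  Write \<open>h = 1 - x - y\<close>.  Up to powers of \<open>x\<close> and \<open>y\<close>, every differentiation in the Rodrigues
  formula is \<open>x \<partial>\<^sub>x + \<mu>\<close> or \<open>y \<partial>\<^sub>y + \<nu>\<close>, and it maps \<open>h\<^sup>r g\<close> to \<open>h\<^bsup>r-1\<^esup> g'\<close> for a polynomial
  \<open>g'\<close> of degree at most one more than that of \<open>g\<close>.  Integration by parts (on monomials:
  the functional equation of the Gamma function in Dirichlet's integral) shows that
  \<open>f \<mapsto> \<integral> x\<^sup>p y\<^sup>q f\<close> is an eigenfunctional of these operators, with eigenvalues \<open>\<mu> - p - 1\<close> and
  \<open>\<nu> - q - 1\<close>.  So the moments of the polynomial are a product of such factors over all
  \<open>n 1 + n 2\<close> differentiations, whatever their order; for \<open>p = \<alpha> j + l\<close>, \<open>q = \<beta> j + m\<close> one factor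
  vanishes as soon as \<open>l < n j - k j\<close> or \<open>m < k j\<close>.  These moments are the Laurent coefficients of
  the remainder, by expanding the Cauchy kernel into geometric series.
\<close>

section \<open>Dirichlet integrals over the triangle\<close>

lemma measurable_std_triangle [measurable]: "std_triangle \<in> sets borel"
proof -
  have "closed {p :: real \<times> real. fst p \<ge> 0 \<and> snd p \<ge> 0 \<and> fst p + snd p \<le> 1}"
    by (intro closed_Collect_conj closed_Collect_le continuous_intros)
  thus ?thesis
    by (auto simp: std_triangle_def case_prod_unfold)
qed

lemma measurable_weight [measurable]:
  assumes "f \<in> borel_measurable M" "g \<in> borel_measurable M"
  shows "(\<lambda>t. weight p q r (f t) (g t)) \<in> borel_measurable M"
  unfolding weight_def using assms by measurable

lemma measurable_fst_snd_real [measurable]: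
  "fst \<in> borel_measurable (borel :: (real \<times> real) measure)"
  "snd \<in> borel_measurable (borel :: (real \<times> real) measure)"
  by (intro borel_measurable_continuous_onI continuous_intros)+

lemma weight_nonneg: "weight p q r x y \<ge> 0"
  by (simp add: weight_def)

lemma Beta_real_nonneg: "a > 0 \<Longrightarrow> b > 0 \<Longrightarrow> Beta a b \<ge> (0::real)"
  by (auto simp: Beta_def intro!: divide_nonneg_nonneg mult_nonneg_nonneg Gamma_real_nonneg)

text \<open>The substitution x = c u reduces this to Euler's Beta integral on the unit interval. A
  general length c is wanted because a horizontal slice of the triangle has length 1 - y.\<close>

lemma nn_integral_Beta_scaled:
  fixes p r c :: real
  assumes "p > -1" "r > -1" "c > 0"
  shows "(\<integral>\<^sup>+x. ennreal (x powr p * (c - x) powr r) * indicator {0..c} x \<partial>lborel)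
           = ennreal (c powr (p + r + 1) * Beta (p + 1) (r + 1))"
proof -
  have "(\<integral>\<^sup>+x. ennreal (x powr p * (c - x) powr r) * indicator {0..c} x \<partial>lborel)
      = \<bar>c\<bar> * (\<integral>\<^sup>+x. ennreal ((0 + c * x) powr p * (c - (0 + c * x)) powr r)
          * indicator {0..c} (0 + c * x) \<partial>lborel)"
    using assms by (subst nn_integral_real_affine[where c = c and t = 0]) auto
  also have "(\<integral>\<^sup>+x. ennreal ((0 + c * x) powr p * (c - (0 + c * x)) powr r)
          * indicator {0..c} (0 + c * x) \<partial>lborel)
      = (\<integral>\<^sup>+x. ennreal (c powr (p + r)) *
          (ennreal (x powr (p + 1 - 1) * (1 - x) powr (r + 1 - 1)) * indicator {0..1} x) \<partial>lborel)"
  proof (intro nn_integral_cong)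
    fix x :: real
    show "ennreal ((0 + c * x) powr p * (c - (0 + c * x)) powr r) * indicator {0..c} (0 + c * x)
        = ennreal (c powr (p + r)) *
          (ennreal (x powr (p + 1 - 1) * (1 - x) powr (r + 1 - 1)) * indicator {0..1} x)"
    proof (cases "x \<in> {0..1}")
      case True
      have "c - c * x = c * (1 - x)"
        by (simp add: algebra_simps)
      moreover have "c * x \<le> c"
        using True assms by (simp add: mult_left_le)
      ultimately show ?thesis
        using True assms
        by (simp add: powr_mult powr_add mult_ac flip: ennreal_mult)
    next
      case False
      with assms have "c * x \<notin> {0..c}"
        by (auto simp: zero_le_mult_iff)
      with False show ?thesis by simp
    qed
  qed
  also have "\<dots> = ennreal (c powr (p + r)) *
      (\<integral>\<^sup>+x. ennreal (x powr (p + 1 - 1) * (1 - x) powr (r + 1 - 1)) * indicator {0..1} x \<partial>lborel)"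
    by (rule nn_integral_cmult) measurable
  also have "(\<integral>\<^sup>+x. ennreal (x powr (p + 1 - 1) * (1 - x) powr (r + 1 - 1)) * indicator {0..1} x \<partial>lborel)
      = ennreal (Beta (p + 1) (r + 1))"
    using assms by (intro nn_integral_has_integral_lebesgue' has_integral_Beta_real) auto
  also have "ennreal \<bar>c\<bar> * (ennreal (c powr (p + r)) * ennreal (Beta (p + 1) (r + 1)))
      = ennreal (c powr (p + r + 1) * Beta (p + 1) (r + 1))"
    using assms by (simp add: powr_add mult_ac Beta_real_nonneg flip: ennreal_mult)
  finally show ?thesis .
qed

text \<open>Dirichlet's integral: for exponents above -1 this is the total mass of
  \<open>weight p q r\<close> on the triangle, the Beta function of the three arguments p + 1, q +
  1, r + 1.\<close>

definition dirichlet :: "real \<Rightarrow> real \<Rightarrow> real \<Rightarrow> real" where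
  "dirichlet p q r = Gamma (p + 1) * Gamma (q + 1) * Gamma (r + 1) / Gamma (p + q + r + 3)"

text \<open>Integrating over x first gives a Beta value times a power of 1 - y, and the y-integral
  is then a second Beta integral. With nonnegative integrals Tonelli applies directly, and
  integrability follows afterwards from the finite value.\<close>

lemma nn_integral_weight:
  assumes "p > -1" "q > -1" "r > -1"
  shows "(\<integral>\<^sup>+t. ennreal (weight p q r (fst t) (snd t)) * indicator std_triangle t \<partial>lborel)
           = ennreal (dirichlet p q r)"
proof -
  have "(\<integral>\<^sup>+t. ennreal (weight p q r (fst t) (snd t)) * indicator std_triangle t \<partial>lborel)
      = (\<integral>\<^sup>+t. (\<lambda>(x, y). ennreal (weight p q r x y) * indicator std_triangle (x, y)) t
           \<partial>(lborel \<Otimes>\<^sub>M lborel))"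
    by (simp add: lborel_prod case_prod_unfold)
  also have "\<dots> = (\<integral>\<^sup>+y. \<integral>\<^sup>+x. ennreal (weight p q r x y) * indicator std_triangle (x, y)
           \<partial>lborel \<partial>lborel)"
  proof -
    have "(\<lambda>t. ennreal (weight p q r (fst t) (snd t)) * indicator std_triangle t)
        \<in> borel_measurable (lborel \<Otimes>\<^sub>M lborel)"
      unfolding lborel_prod by simp
    from lborel_pair.nn_integral_snd[OF this] show ?thesis
      by (simp add: case_prod_unfold)
  qed
  also have "\<dots> = (\<integral>\<^sup>+y. ennreal (Beta (p + 1) (r + 1)) *
      (ennreal (y powr (q + 1 - 1) * (1 - y) powr (p + r + 2 - 1)) * indicator {0..1} y) \<partial>lborel)"
  \<comment> \<open>At y = 1 the slice shrinks to a point, while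
    \<open>nn_integral_Beta_scaled\<close> needs positive length; this null set is
    discarded.\<close>
  proof (rule nn_integral_cong_AE, rule AE_mp[OF AE_lborel_singleton[of 1]], rule AE_I2, rule impI)
    fix y :: real
    assume "y \<noteq> 1"
    show "(\<integral>\<^sup>+x. ennreal (weight p q r x y) * indicator std_triangle (x, y) \<partial>lborel)
        = ennreal (Beta (p + 1) (r + 1)) *
          (ennreal (y powr (q + 1 - 1) * (1 - y) powr (p + r + 2 - 1)) * indicator {0..1} y)"
    proof (cases "y \<in> {0..1}")
      case True
      with \<open>y \<noteq> 1\<close> have y: "0 \<le> y" "y < 1" by auto
      have "(\<integral>\<^sup>+x. ennreal (weight p q r x y) * indicator std_triangle (x, y) \<partial>lborel)
          = (\<integral>\<^sup>+x. ennreal (y powr q) *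
              (ennreal (x powr p * ((1 - y) - x) powr r) * indicator {0..1 - y} x) \<partial>lborel)"
      proof (intro nn_integral_cong)
        fix x :: real
        have [simp]: "(1 - x - y) powr r = (1 - y - x) powr r"
          by (rule arg_cong) simp
        show "ennreal (weight p q r x y) * indicator std_triangle (x, y)
            = ennreal (y powr q) *
              (ennreal (x powr p * ((1 - y) - x) powr r) * indicator {0..1 - y} x)"
          using y by (auto simp: weight_def std_triangle_def indicator_def mult_ac
              simp flip: ennreal_mult)
      qed
      also have "\<dots> = ennreal (y powr q) *
          (\<integral>\<^sup>+x. ennreal (x powr p * ((1 - y) - x) powr r) * indicator {0..1 - y} x \<partial>lborel)"
        by (rule nn_integral_cmult) measurable
      also have "\<dots> = ennreal (y powr q) *
          ennreal ((1 - y) powr (p + r + 1) * Beta (p + 1) (r + 1))"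
        using assms y by (subst nn_integral_Beta_scaled) auto
      finally show ?thesis
        using True assms by (simp add: mult_ac Beta_real_nonneg add_ac flip: ennreal_mult)
    next
      case False
      then have "indicator std_triangle (x, y) = (0 :: ennreal)" for x
        by (auto simp: std_triangle_def)
      with False show ?thesis by simp
    qed
  qed
  also have "\<dots> = ennreal (Beta (p + 1) (r + 1)) *
      (\<integral>\<^sup>+y. ennreal (y powr (q + 1 - 1) * (1 - y) powr (p + r + 2 - 1)) * indicator {0..1} y \<partial>lborel)"
    by (rule nn_integral_cmult) measurable
  also have "(\<integral>\<^sup>+y. ennreal (y powr (q + 1 - 1) * (1 - y) powr (p + r + 2 - 1)) * indicator {0..1} y \<partial>lborel)
      = ennreal (Beta (q + 1) (p + r + 2))"
    using assms by (intro nn_integral_has_integral_lebesgue' has_integral_Beta_real) auto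
  also have "ennreal (Beta (p + 1) (r + 1)) * ennreal (Beta (q + 1) (p + r + 2))
      = ennreal (Beta (p + 1) (r + 1) * Beta (q + 1) (p + r + 2))"
    using assms by (simp add: Beta_real_nonneg flip: ennreal_mult)
  also have "Beta (p + 1) (r + 1) * Beta (q + 1) (p + r + 2) = dirichlet p q r"
  proof -
    \<comment> \<open>This value is the denominator of the first Beta factor and a numerator of the
      second; being nonzero, it cancels.\<close>
    have "Gamma (p + r + 2) > 0"
      using assms by (intro Gamma_real_pos) auto
    then show ?thesis
      by (simp add: Beta_def dirichlet_def add_ac)
  qed
  finally show ?thesis .
qed

lemma has_bochner_integral_weight:
  assumes "p > -1" "q > -1" "r > -1"
  shows "has_bochner_integral lborel
           (\<lambda>t. indicator std_triangle t * weight p q r (fst t) (snd t)) (dirichlet p q r)"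
proof (rule has_bochner_integral_nn_integral)
  show "0 \<le> dirichlet p q r"
    using assms by (auto simp: dirichlet_def intro!: mult_nonneg_nonneg divide_nonneg_nonneg)
  show "(\<integral>\<^sup>+t. ennreal (indicator std_triangle t * weight p q r (fst t) (snd t)) \<partial>lborel)
      = ennreal (dirichlet p q r)"
    unfolding nn_integral_weight[OF assms, symmetric]
    by (intro nn_integral_cong) (auto simp: indicator_def)
  show "(\<lambda>t. indicator std_triangle t * weight p q r (fst t) (snd t)) \<in> borel_measurable lborel"
    by measurable
qed (simp_all add: weight_nonneg)

section \<open>Polynomials in two variables\<close>

lemma eval2_0 [simp]: "eval2 0 x y = 0"
  by (simp add: eval2_def)

lemma eval2_pCons [simp]:
  "eval2 (pCons q p) x y = poly (map_poly of_real q) x + y * eval2 p x y"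
  by (simp add: eval2_def map_poly_pCons)

lemma poly_of_real_add:
  "poly (map_poly of_real (p + q)) (x :: 'a :: real_field)
     = poly (map_poly of_real p) x + poly (map_poly of_real q) x"
  by (induction p q rule: poly_induct2) (simp_all add: map_poly_pCons algebra_simps)

lemma poly_of_real_mult:
  "poly (map_poly of_real (p * q)) (x :: 'a :: real_field)
     = poly (map_poly of_real p) x * poly (map_poly of_real q) x"
proof (induction p)
  case (pCons a p)
  have "poly (map_poly of_real (smult a q)) x = of_real a * poly (map_poly of_real q) x"
    by (simp add: map_poly_smult)
  then show ?case
    using pCons by (simp add: poly_of_real_add map_poly_pCons algebra_simps)
qed simp

lemma eval2_add: "eval2 (p + q) x y = eval2 p x y + eval2 q x y"
  by (induction p q rule: poly_induct2) (simp_all add: poly_of_real_add algebra_simps)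

lemma eval2_mult: "eval2 (p * q) x y = eval2 p x y * eval2 q x y"
proof (induction p)
  case (pCons a p)
  have "eval2 (smult a q) x y = poly (map_poly of_real a) x * eval2 q x y"
    by (induction q) (simp_all add: poly_of_real_mult algebra_simps)
  then show ?case
    using pCons by (simp add: eval2_add algebra_simps)
qed simp

lemma eval2_minus: "eval2 (p - q) x y = eval2 p x y - eval2 q x y"
  using eval2_add[of "p - q" q x y] by simp

lemma eval2_monom: "eval2 (monom (monom c i) j) x y = of_real c * x ^ i * y ^ j"
  by (simp add: eval2_def map_poly_monom poly_monom)

text \<open>Every polynomial is a finite sum of monomials. The sums over \<open>i\<le>d\<close> are
  never empty, so they start from a monomial; the zero polynomial is the monomial with c =
  0.\<close>

lemma bivariate_poly_induct [case_names add monom]: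
  fixes p :: "'a::comm_monoid_add poly poly"
  assumes add: "\<And>p q. P p \<Longrightarrow> P q \<Longrightarrow> P (p + q)"
    and monom: "\<And>c i j. P (monom (monom c i) j)"
  shows "P p"
proof -
  have sum: "P (\<Sum>i\<le>d. f i)" if "\<And>i. P (f i)" for f and d :: nat
    using that by (induction d) (auto intro: add)
  have P1: "P (monom q j)" for q j
  proof -
    have "monom (\<Sum>i\<le>d. f i) j = (\<Sum>i\<le>d. monom (f i) j)" for f :: "nat \<Rightarrow> 'a poly" and d :: nat
      by (induction d) (simp_all flip: add_monom)
    then have "monom q j = (\<Sum>i\<le>degree q. monom (monom (coeff q i) i) j)"
      by (metis poly_as_sum_of_monoms)
    then show ?thesis
      using sum[of "\<lambda>i. monom (monom (coeff q i) i) j"] monom by metis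
  qed
  show ?thesis
    using sum[of "\<lambda>i. monom (coeff p i) i"] P1 by (metis poly_as_sum_of_monoms)
qed

lemma DERIV_eval2_x:
  "((\<lambda>s. eval2 p s y) has_real_derivative eval2 (map_poly pderiv p) x y) (at x)"
proof (induction p)
  case (pCons q p)
  then show ?case
    by (auto simp: map_poly_pCons map_poly_idI intro!: derivative_eq_intros)
qed simp

lemma DERIV_eval2_y: "((\<lambda>t. eval2 p x t) has_real_derivative eval2 (pderiv p) x y) (at y)"
proof (induction p)
  case (pCons q p)
  then show ?case
    by (auto simp: pderiv_pCons eval2_add intro!: derivative_eq_intros)
qed simp

text \<open>For fixed x the difference has infinitely many zeros in y, so each of its coefficients
  vanishes at x; being a polynomial with infinitely many roots, each coefficient is zero. This gives
  the uniqueness behind the \<open>THE\<close> in \<open>U_poly\<close>.\<close>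

lemma eval2_eqI:
  fixes p q :: "real poly poly" and a b c d :: real
  assumes "a < b" "c < d" and eq: "\<And>x y. x \<in> {a<..<b} \<Longrightarrow> y \<in> {c<..<d} \<Longrightarrow> eval2 p x y = eval2 q x y"
  shows "p = q"
proof -
  have "coeff (p - q) j = 0" for j
  proof (rule ccontr)
    assume nz: "coeff (p - q) j \<noteq> 0"
    have "poly (coeff (p - q) j) x = 0" if "x \<in> {a<..<b}" for x :: real
    proof -
      let ?f = "map_poly (\<lambda>r. poly r x) (p - q)"
      have "poly ?f y = 0" if "y \<in> {c<..<d}" for y
        using eq[OF \<open>x \<in> _\<close> that] eval2_minus[of p q x y]
        by (simp add: eval2_def map_poly_idI)
      then have "{c<..<d} \<subseteq> {y. poly ?f y = 0}"
        by blast
      with \<open>c < d\<close> have "?f = 0"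
        by (metis finite_subset infinite_Ioo poly_roots_finite)
      then have "coeff ?f j = 0"
        by simp
      then show ?thesis
        by (simp add: coeff_map_poly)
    qed
    then have "{a<..<b} \<subseteq> {x. poly (coeff (p - q) j) x = 0}"
      by blast
    with nz \<open>a < b\<close> show False
      by (metis finite_subset infinite_Ioo poly_roots_finite)
  qed
  then show ?thesis
    by (simp add: poly_eq_iff)
qed

section \<open>Total degree under ring operations\<close>

lemma total_degree_le_add:
  fixes p q :: "'a::comm_monoid_add poly poly"
  shows "total_degree_le p a \<Longrightarrow> total_degree_le q a \<Longrightarrow> total_degree_le (p + q) a"
  unfolding total_degree_le_def by (metis add.right_neutral coeff_add)

lemma total_degree_le_diff:
  fixes p q :: "'a::ab_group_add poly poly"
  shows "total_degree_le p a \<Longrightarrow> total_degree_le q a \<Longrightarrow> total_degree_le (p - q) a"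
  unfolding total_degree_le_def by (metis coeff_diff diff_zero)

lemma total_degree_le_mult:
  fixes p q :: "'a::comm_semiring_0 poly poly"
  assumes "total_degree_le p a" "total_degree_le q b"
  shows "total_degree_le (p * q) (a + b)"
  unfolding total_degree_le_def
proof (intro allI impI)
  fix i j
  assume "coeff (coeff (p * q) j) i \<noteq> 0"
  then have "(\<Sum>s\<le>j. \<Sum>t\<le>i. coeff (coeff p s) t * coeff (coeff q (j - s)) (i - t)) \<noteq> 0"
    by (simp add: coeff_mult coeff_sum)
  then obtain s t where "s \<le> j" "t \<le> i"
    "coeff (coeff p s) t * coeff (coeff q (j - s)) (i - t) \<noteq> 0"
    by (metis (no_types, lifting) atMost_iff sum.neutral)
  then have "t + s \<le> a" "(i - t) + (j - s) \<le> b"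
    using assms unfolding total_degree_le_def by (metis mult_zero_left mult_zero_right)+
  with \<open>s \<le> j\<close> \<open>t \<le> i\<close> show "i + j \<le> a + b"
    by linarith
qed

section \<open>The Rodrigues formula on polynomials\<close>

definition const2 :: "real \<Rightarrow> real poly poly" where
  "const2 c = [:[:c:]:]"

definition var_x :: "real poly poly" where
  "var_x = [:[:0, 1:]:]"

definition var_y :: "real poly poly" where
  "var_y = [:0, 1:]"

definition height :: "real poly poly" where
  "height = [:[:1, -1:], [:-1:]:]"

lemma eval2_generators [simp]:
  "eval2 (const2 c) x y = of_real c" "eval2 var_x x y = x" "eval2 var_y x y = y"
  "eval2 height x y = 1 - x - y"
  by (simp_all add: const2_def var_x_def var_y_def height_def map_poly_pCons)

definition euler_x :: "real poly poly \<Rightarrow> real poly poly" where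
  "euler_x g = var_x * map_poly pderiv g"

definition euler_y :: "real poly poly \<Rightarrow> real poly poly" where
  "euler_y g = var_y * pderiv g"

text \<open>
  With \<open>h = 1 - x - y\<close>, the operator \<open>x \<partial>\<^sub>x + \<mu>\<close> maps \<open>h\<^sup>r g\<close> to
  \<open>h\<^bsup>r-1\<^esup>\<close> times \<open>rodrigues_step_x \<mu> r g\<close>, and likewise for \<open>y\<close>.
\<close>

definition rodrigues_step_x :: "real \<Rightarrow> real \<Rightarrow> real poly poly \<Rightarrow> real poly poly" where
  "rodrigues_step_x \<mu> r g = height * (const2 \<mu> * g + euler_x g) - const2 r * (var_x * g)"

definition rodrigues_step_y :: "real \<Rightarrow> real \<Rightarrow> real poly poly \<Rightarrow> real poly poly" where
  "rodrigues_step_y \<nu> r g = height * (const2 \<nu> * g + euler_y g) - const2 r * (var_y * g)"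

text \<open>Every differentiation lowers the exponents of x and of h = 1 - x - y by one, hence the
  shifts by i.\<close>

primrec rodrigues_steps_x :: "real \<Rightarrow> real \<Rightarrow> nat \<Rightarrow> real poly poly \<Rightarrow> real poly poly" where
  "rodrigues_steps_x \<mu> r 0 g = g"
| "rodrigues_steps_x \<mu> r (Suc i) g = rodrigues_step_x (\<mu> - i) (r - i) (rodrigues_steps_x \<mu> r i g)"

primrec rodrigues_steps_y :: "real \<Rightarrow> real \<Rightarrow> nat \<Rightarrow> real poly poly \<Rightarrow> real poly poly" where
  "rodrigues_steps_y \<nu> r 0 g = g"
| "rodrigues_steps_y \<nu> r (Suc i) g = rodrigues_step_y (\<nu> - i) (r - i) (rodrigues_steps_y \<nu> r i g)"

text \<open>Here r is the full exponent of h, that of the weight included. As in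
  \<open>mixed_partial\<close>, the y-derivatives come first; they use up k powers of h, so the
  x-derivatives start from r - k.\<close>

definition rodrigues_poly ::
    "real \<Rightarrow> real \<Rightarrow> real \<Rightarrow> nat \<Rightarrow> nat \<Rightarrow> real poly poly \<Rightarrow> real poly poly" where
  "rodrigues_poly \<alpha> \<beta> r n k g =
     rodrigues_steps_x (\<alpha> + real (n - k)) (r - real k) (n - k) (rodrigues_steps_y (\<beta> + real k) r k g)"

lemma total_degree_le_generators [simp]:
  "total_degree_le (const2 c) 0" "total_degree_le var_x 1" "total_degree_le var_y 1" "total_degree_le height 1"
  by (auto simp: total_degree_le_def const2_def var_x_def var_y_def height_def coeff_pCons
      split: nat.splits)

text \<open>The Euler operators are diagonal on monomials. Both the degree bound and the moment
  formulas rest on this.\<close>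

lemma coeff_euler:
  "coeff (coeff (euler_x g) j) i = of_nat i * coeff (coeff g j) i"
  "coeff (coeff (euler_y g) j) i = of_nat j * coeff (coeff g j) i"
  by (simp_all add: euler_x_def euler_y_def var_x_def var_y_def coeff_map_poly coeff_pCons coeff_pderiv
      of_nat_poly split: nat.splits)

lemma total_degree_le_euler:
  assumes "total_degree_le g d"
  shows "total_degree_le (euler_x g) d" "total_degree_le (euler_y g) d"
  using assms by (auto simp: total_degree_le_def coeff_euler)

lemma total_degree_le_rodrigues_step:
  assumes "total_degree_le g d"
  shows "total_degree_le (rodrigues_step_x \<mu> r g) (Suc d)" "total_degree_le (rodrigues_step_y \<mu> r g) (Suc d)"
proof -
  have c: "total_degree_le (const2 c * p) e" if "total_degree_le p e" for c p e
    using total_degree_le_mult[OF total_degree_le_generators(1)[of c] that] by simp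
  have 1: "total_degree_le (q * p) (Suc d)" if "total_degree_le q 1" "total_degree_le p d"
    for p q :: "real poly poly"
    using total_degree_le_mult[OF that] by simp
  show "total_degree_le (rodrigues_step_x \<mu> r g) (Suc d)" "total_degree_le (rodrigues_step_y \<mu> r g) (Suc d)"
    unfolding rodrigues_step_x_def rodrigues_step_y_def
    by (intro total_degree_le_diff 1 c total_degree_le_add total_degree_le_euler assms
        total_degree_le_generators)+
qed

lemma total_degree_le_rodrigues_poly:
  assumes "total_degree_le g d" "k \<le> n"
  shows "total_degree_le (rodrigues_poly \<alpha> \<beta> r n k g) (d + n)"
proof -
  have x: "total_degree_le (rodrigues_steps_x \<mu> r i p) (e + i)" if "total_degree_le p e" for \<mu> r i p e
    by (induction i) (use that in \<open>auto intro: total_degree_le_rodrigues_step\<close>)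
  have y: "total_degree_le (rodrigues_steps_y \<mu> r i p) (e + i)" if "total_degree_le p e" for \<mu> r i p e
    by (induction i) (use that in \<open>auto intro: total_degree_le_rodrigues_step\<close>)
  show ?thesis
    unfolding rodrigues_poly_def
    using x[OF y[OF assms(1)], of _ _ "n - k" _ _ k] assms(2) by (simp add: add.assoc)
qed

section \<open>Differentiating powers of x, y and h times a polynomial\<close>

lemma eval2_rodrigues_step_x:
  "eval2 (rodrigues_step_x \<mu> r g) x y =
     (1 - x - y) * (\<mu> * eval2 g x y + x * eval2 (map_poly pderiv g) x y) - r * x * eval2 g x (y::real)"
  by (simp add: rodrigues_step_x_def euler_x_def eval2_minus eval2_add eval2_mult algebra_simps)

lemma eval2_rodrigues_step_y:
  "eval2 (rodrigues_step_y \<nu> r g) x y =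
     (1 - x - y) * (\<nu> * eval2 g x y + y * eval2 (pderiv g) x y) - r * y * eval2 g x (y::real)"
  by (simp add: rodrigues_step_y_def euler_y_def eval2_minus eval2_add eval2_mult algebra_simps)

lemma powr_diff_one_mult: "x > 0 \<Longrightarrow> x powr p = x powr (p - 1) * (x::real)"
  by (simp add: powr_diff)

text \<open>The product rule gives terms with exponents \<mu> or \<mu> - 1 and r or r - 1; taking
  out the lower powers leaves one factor x or h, and the rest is the polynomial step.\<close>

lemma DERIV_rodrigues_step_x:
  assumes "x > 0" "x + y < 1"
  shows "((\<lambda>s. s powr \<mu> * (1 - s - y) powr r * eval2 g s y) has_real_derivative
            x powr (\<mu> - 1) * (1 - x - y) powr (r - 1) * eval2 (rodrigues_step_x \<mu> r g) x y) (at x)"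
proof -
  define h where "h = 1 - x - y"
  have "h > 0" using assms by (simp add: h_def)
  have "((\<lambda>s. s powr \<mu> * (1 - s - y) powr r * eval2 g s y) has_real_derivative
      (\<mu> * x powr (\<mu> - 1) * h powr r - x powr \<mu> * (r * h powr (r - 1))) * eval2 g x y
        + x powr \<mu> * h powr r * eval2 (map_poly pderiv g) x y) (at x)"
    using assms \<open>h > 0\<close> unfolding h_def
    by (auto intro!: derivative_eq_intros DERIV_eval2_x simp: algebra_simps)
  also have "(\<mu> * x powr (\<mu> - 1) * h powr r - x powr \<mu> * (r * h powr (r - 1))) * eval2 g x y
        + x powr \<mu> * h powr r * eval2 (map_poly pderiv g) x y
      = x powr (\<mu> - 1) * h powr (r - 1) * eval2 (rodrigues_step_x \<mu> r g) x y"
    unfolding eval2_rodrigues_step_x powr_diff_one_mult[OF assms(1), of \<mu>]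
      powr_diff_one_mult[OF \<open>h > 0\<close>, of r] h_def[symmetric]
    by (simp add: algebra_simps)
  finally show ?thesis
    by (simp add: h_def)
qed

lemma DERIV_rodrigues_step_y:
  assumes "y > 0" "x + y < 1"
  shows "((\<lambda>t. t powr \<nu> * (1 - x - t) powr r * eval2 g x t) has_real_derivative
            y powr (\<nu> - 1) * (1 - x - y) powr (r - 1) * eval2 (rodrigues_step_y \<nu> r g) x y) (at y)"
proof -
  define h where "h = 1 - x - y"
  have "h > 0" using assms by (simp add: h_def)
  have "((\<lambda>t. t powr \<nu> * (1 - x - t) powr r * eval2 g x t) has_real_derivative
      (\<nu> * y powr (\<nu> - 1) * h powr r - y powr \<nu> * (r * h powr (r - 1))) * eval2 g x y
        + y powr \<nu> * h powr r * eval2 (pderiv g) x y) (at y)"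
    using assms \<open>h > 0\<close> unfolding h_def
    by (auto intro!: derivative_eq_intros DERIV_eval2_y simp: algebra_simps)
  also have "(\<nu> * y powr (\<nu> - 1) * h powr r - y powr \<nu> * (r * h powr (r - 1))) * eval2 g x y
        + y powr \<nu> * h powr r * eval2 (pderiv g) x y
      = y powr (\<nu> - 1) * h powr (r - 1) * eval2 (rodrigues_step_y \<nu> r g) x y"
    unfolding eval2_rodrigues_step_y powr_diff_one_mult[OF assms(1), of \<nu>]
      powr_diff_one_mult[OF \<open>h > 0\<close>, of r] h_def[symmetric]
    by (simp add: algebra_simps)
  finally show ?thesis
    by (simp add: h_def)
qed

text \<open>An iterated \<open>deriv\<close> at x depends on the lower derivatives near x, so the
  chain F must be known on an open set; each step transfers the derivative of F along local
  equality.\<close>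

lemma higher_deriv_chain:
  fixes f :: "real \<Rightarrow> real"
  assumes "open S"
    and "\<And>x. x \<in> S \<Longrightarrow> f x = F 0 x"
    and "\<And>i x. i < n \<Longrightarrow> x \<in> S \<Longrightarrow> (F i has_real_derivative F (Suc i) x) (at x)"
    and "x \<in> S"
  shows "(deriv ^^ n) f x = F n x"
  using assms(3,4)
proof (induction n arbitrary: x)
  case 0
  then show ?case using assms(2) by simp
next
  case (Suc n)
  have "((deriv ^^ n) f has_real_derivative F (Suc n) x) (at x)"
  proof (rule has_field_derivative_transform_within_open)
    show "(F n has_real_derivative F (Suc n) x) (at x)"
      using Suc.prems by simp
    show "F n y = (deriv ^^ n) f y" if "y \<in> S" for y
      using Suc that by simp
  qed (use assms Suc.prems in auto)
  then show ?case
    by (simp add: DERIV_imp_deriv)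
qed

lemma interior_std_triangle: "interior std_triangle = {(x, y). 0 < x \<and> 0 < y \<and> x + y < 1}"
  (is "_ = ?S")
proof (rule interior_unique)
  show "?S \<subseteq> std_triangle"
    by (auto simp: std_triangle_def)
  have "open {p :: real \<times> real. 0 < fst p \<and> 0 < snd p \<and> fst p + snd p < 1}"
    by (intro open_Collect_conj open_Collect_less continuous_intros)
  then show "open ?S"
    by (simp add: case_prod_unfold)
  fix T assume T: "T \<subseteq> std_triangle" "open T"
  show "T \<subseteq> ?S"
  proof
    fix t assume "t \<in> T"
    obtain x y where t: "t = (x, y)" by force
    obtain e where e: "e > 0" "\<And>s. dist s t < e \<Longrightarrow> s \<in> T"
      using T \<open>t \<in> T\<close> by (metis open_dist)
    have *: "0 \<le> a \<and> 0 \<le> b \<and> a + b \<le> 1" if "\<bar>a - x\<bar> + \<bar>b - y\<bar> < e" for a b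
    proof -
      have "dist (a, b) t \<le> \<bar>a - x\<bar> + \<bar>b - y\<bar>"
        using t by (simp add: dist_Pair_Pair dist_real_def sqrt_sum_squares_le_sum_abs)
      with that e(2)[of "(a, b)"] T(1) have "(a, b) \<in> std_triangle"
        by auto
      then show ?thesis
        by (simp add: std_triangle_def)
    qed
    \<comment> \<open>Shifting both coordinates by e/3 costs 2e/3 < e in the sum of distances. The
      shift down forces x, y > 0, the shift up forces x + y < 1.\<close>
    show "t \<in> ?S"
      using *[of "x - e / 3" "y - e / 3"] *[of "x + e / 3" "y + e / 3"] e(1) t by auto
  qed
qed

text \<open>Inside the triangle the function to be differentiated is a power of x times a power of y
  times h to the power \<gamma> + s times g, and each of the n derivatives costs one power of h. The
  result has the same shape as f, so the lemma can be iterated.\<close>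

lemma rodrigues_op_eq_rodrigues_poly:
  assumes f: "\<And>x y. (x, y) \<in> interior std_triangle \<Longrightarrow> f x y = (1 - x - y) ^ s * eval2 g x y"
    and "n \<le> s" "k \<le> n" and xy: "(x, y) \<in> interior std_triangle"
  shows "rodrigues_op \<alpha> \<beta> \<gamma> n k f x y
           = (1 - x - y) ^ (s - n) * eval2 (rodrigues_poly \<alpha> \<beta> (\<gamma> + real s) n k g) x y"
proof -
  have x: "x > 0" and y: "y > 0" and h: "x + y < 1"
    using xy by (auto simp: interior_std_triangle)
  define a where "a = n - k"
  define G where "G = (\<lambda>x y. weight \<alpha> \<beta> \<gamma> x y * x ^ a * y ^ k * f x y)"
  \<comment> \<open>\<open>Fy u i t\<close> is the i-th y-derivative on the vertical line at u;
    \<open>Fx i u\<close> below is the i-th x-derivative of the k-th y-derivative, whose y-exponent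
    has dropped to \<beta>.\<close>
  define Fy where "Fy = (\<lambda>u i t. u powr (\<alpha> + real a) * (t powr (\<beta> + real k - real i) *
      (1 - u - t) powr (\<gamma> + real s - real i) * eval2 (rodrigues_steps_y (\<beta> + real k) (\<gamma> + real s) i g) u t))"
  define q where "q = rodrigues_steps_y (\<beta> + real k) (\<gamma> + real s) k g"
  define Fx where "Fx = (\<lambda>i u. y powr \<beta> * (u powr (\<alpha> + real a - real i) *
      (1 - u - y) powr (\<gamma> + real s - real k - real i) *
      eval2 (rodrigues_steps_x (\<alpha> + real a) (\<gamma> + real s - real k) i q) u y))"
  have G: "G u t = Fy u 0 t" if "0 < u" "0 < t" "u + t < 1" for u t
    using that f[of u t]
    by (simp add: G_def Fy_def weight_def interior_std_triangle powr_add powr_realpow)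
  \<comment> \<open>This is needed for all u in an interval around x, because the x-derivatives act
    on it next.\<close>
  have dy: "(deriv ^^ k) (G u) y = Fx 0 u" if u: "u \<in> {0<..<1 - y}" for u
  proof -
    have "(deriv ^^ k) (G u) y = Fy u k y"
    proof (rule higher_deriv_chain[of "{0<..<1 - u}"])
      show "(Fy u i has_real_derivative Fy u (Suc i) t) (at t)" if "t \<in> {0<..<1 - u}" for i t
        unfolding Fy_def
        using DERIV_rodrigues_step_y[of t u "\<beta> + real k - real i" "\<gamma> + real s - real i"
            "rodrigues_steps_y (\<beta> + real k) (\<gamma> + real s) i g"] that
        by (intro DERIV_cmult) (simp add: diff_diff_eq add_ac)
    qed (use u y G in auto)
    then show ?thesis
      by (simp add: Fy_def Fx_def q_def mult_ac)
  qed
  have "mixed_partial a k G x y = Fx a x"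
    unfolding mixed_partial_def
  proof (rule higher_deriv_chain[of "{0<..<1 - y}"])
    show "(Fx i has_real_derivative Fx (Suc i) u) (at u)" if "u \<in> {0<..<1 - y}" for i u
      unfolding Fx_def
      using DERIV_rodrigues_step_x[of u y "\<alpha> + real a - real i" "\<gamma> + real s - real k - real i"
          "rodrigues_steps_x (\<alpha> + real a) (\<gamma> + real s - real k) i q"] that
      by (intro DERIV_cmult) (simp add: diff_diff_eq add_ac)
  qed (use x y h dy in auto)
  also have "\<dots> = weight \<alpha> \<beta> \<gamma> x y *
      ((1 - x - y) ^ (s - n) * eval2 (rodrigues_poly \<alpha> \<beta> (\<gamma> + real s) n k g) x y)"
  proof -
    have e: "\<gamma> + real s - real k - real a = \<gamma> + real (s - n)"
      using \<open>n \<le> s\<close> \<open>k \<le> n\<close> by (simp add: a_def of_nat_diff)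
    show ?thesis
      unfolding Fx_def e using h
      by (simp add: weight_def rodrigues_poly_def powr_add powr_realpow q_def a_def)
  qed
  finally show ?thesis
    using x y h by (simp add: rodrigues_op_def G_def a_def weight_def)
qed

section \<open>Moments\<close>

text \<open>The exponents are parameters so that multiplication by x, y or h is a shift of p, q or
  r; the moment against \<open>x^l * y^m\<close> is the one with p + l and q + m.\<close>

definition moment :: "real \<Rightarrow> real \<Rightarrow> real \<Rightarrow> real poly poly \<Rightarrow> real" where
  "moment p q r g =
     (LINT t:std_triangle|lborel. weight p q r (fst t) (snd t) * eval2 g (fst t) (snd t))"

lemma moment_cong:
  assumes "\<And>x y. (x, y) \<in> std_triangle \<Longrightarrow>
    weight p q r x y * eval2 g x y = weight p' q' r' x y * eval2 g' x y"
  shows "moment p q r g = moment p' q' r' g'"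
  unfolding moment_def using assms by (intro set_lebesgue_integral_cong) auto

lemma powr_mult_power: "x \<ge> 0 \<Longrightarrow> x powr p * x ^ i = x powr (p + real i)"
  \<comment> \<open>At x = 0 both sides are 0, since \<open>0 powr p = 0\<close> for every p, even p
    = 0.\<close>
  by (cases "x = 0") (simp_all add: powr_add powr_realpow)

lemma weight_mult_monomial:
  assumes "(x, y) \<in> std_triangle"
  shows "weight p q r x y * (x ^ i * y ^ j) = weight (p + real i) (q + real j) r x y"
proof -
  have "weight p q r x y * (x ^ i * y ^ j) = (x powr p * x ^ i) * (y powr q * y ^ j) * (1 - x - y) powr r"
    by (simp add: weight_def mult_ac)
  also have "\<dots> = weight (p + real i) (q + real j) r x y"
    using assms by (simp add: weight_def std_triangle_def powr_mult_power)
  finally show ?thesis .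
qed

lemma weight_mult_height:
  assumes "(x, y) \<in> std_triangle"
  shows "weight p q r x y * (1 - x - y) = weight p q (r + 1) x y"
proof -
  have "weight p q r x y * (1 - x - y) = x powr p * y powr q * ((1 - x - y) powr r * (1 - x - y) ^ 1)"
    by (simp add: weight_def mult_ac)
  also have "(1 - x - y) powr r * (1 - x - y) ^ 1 = (1 - x - y) powr (r + real 1)"
    using assms by (intro powr_mult_power) (simp add: std_triangle_def)
  finally show ?thesis
    by (simp add: weight_def)
qed

lemma set_integrable_weight:
  assumes "p > -1" "q > -1" "r > -1"
  shows "set_integrable lborel std_triangle (\<lambda>t. weight p q r (fst t) (snd t))"
  using has_bochner_integral_weight[OF assms] by (simp add: set_integrable_def has_bochner_integral_iff)

lemma
  assumes "p > -1" "q > -1" "r > -1"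
  shows set_integrable_weight_monom: "set_integrable lborel std_triangle
           (\<lambda>t. weight p q r (fst t) (snd t) * eval2 (monom (monom c i) j) (fst t) (snd t))"
    and moment_monom: "moment p q r (monom (monom c i) j) = c * dirichlet (p + real i) (q + real j) r"
proof -
  have eq: "weight p q r (fst t) (snd t) * eval2 (monom (monom c i) j) (fst t) (snd t)
      = weight (p + real i) (q + real j) r (fst t) (snd t) * c" if "t \<in> std_triangle" for t
    using that weight_mult_monomial[of "fst t" "snd t" p q r i j]
    by (simp add: eval2_monom mult_ac)
  have pq: "p + real i > -1" "q + real j > -1"
    using assms by auto
  show "set_integrable lborel std_triangle
      (\<lambda>t. weight p q r (fst t) (snd t) * eval2 (monom (monom c i) j) (fst t) (snd t))"
    using set_integrable_weight[OF pq assms(3)]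
    by (subst set_integrable_cong[OF refl refl eq]) auto
  have "moment p q r (monom (monom c i) j)
      = (LINT t:std_triangle|lborel. weight (p + real i) (q + real j) r (fst t) (snd t) * c)"
    unfolding moment_def using eq by (intro set_lebesgue_integral_cong) auto
  also have "\<dots> = dirichlet (p + real i) (q + real j) r * c"
    using has_bochner_integral_weight[OF pq assms(3)]
    by (simp add: set_lebesgue_integral_def has_bochner_integral_iff)
  finally show "moment p q r (monom (monom c i) j) = c * dirichlet (p + real i) (q + real j) r"
    by simp
qed

lemma set_integrable_weight_eval2:
  assumes "p > -1" "q > -1" "r > -1"
  shows "set_integrable lborel std_triangle
           (\<lambda>t. weight p q r (fst t) (snd t) * eval2 g (fst t) (snd t))"
  by (induction g rule: bivariate_poly_induct)
     (simp_all add: eval2_add distrib_left set_integral_add(1) set_integrable_weight_monom assms)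

lemma moment_add:
  assumes "p > -1" "q > -1" "r > -1"
  shows "moment p q r (f + g) = moment p q r f + moment p q r g"
  using assms
  by (simp add: moment_def eval2_add distrib_left set_integral_add(2) set_integrable_weight_eval2)

lemma moment_diff:
  assumes "p > -1" "q > -1" "r > -1"
  shows "moment p q r (f - g) = moment p q r f - moment p q r g"
  using moment_add[OF assms, of "f - g" g] by simp

lemma moment_const_mult: "moment p q r (const2 c * g) = c * moment p q r g"
proof -
  have "weight p q r x y * eval2 (const2 c * g) x y = c * (weight p q r x y * eval2 g x y)" for x y
    by (simp add: eval2_mult)
  then show ?thesis
    unfolding moment_def by (simp only: set_integral_mult_right)
qed

lemma moment_height_mult: "moment p q r (height * g) = moment p q (r + 1) g"
  by (rule moment_cong)
     (simp add: eval2_mult flip: weight_mult_height)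

lemma moment_x_mult: "moment p q r (var_x * g) = moment (p + 1) q r g"
  by (rule moment_cong)
     (use weight_mult_monomial[of _ _ p q r 1 0] in
       \<open>simp add: eval2_mult \<close>)

lemma moment_y_mult: "moment p q r (var_y * g) = moment p (q + 1) r g"
  by (rule moment_cong)
     (use weight_mult_monomial[of _ _ p q r 0 1] in
       \<open>simp add: eval2_mult \<close>)

text \<open>Both sides have the same exponent sum, hence the same Gamma denominator; the recursion
  of Gamma at p + 1 and r + 1 does the rest. Both arguments are positive and so avoid the
  poles.\<close>

lemma dirichlet_shift_x:
  assumes "p > -1" "r > -1"
  shows "(p + 1) * dirichlet p q (r + 1) = (r + 1) * dirichlet (p + 1) q r"
proof -
  have "Gamma (p + 1 + 1) = (p + 1) * Gamma (p + 1)" "Gamma (r + 1 + 1) = (r + 1) * Gamma (r + 1)"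
    using assms by (intro Gamma_plus1; auto elim!: nonpos_Ints_cases)+
  then show ?thesis
    by (simp add: dirichlet_def add_ac)
qed

lemma dirichlet_commute: "dirichlet p q r = dirichlet q p r"
  by (simp add: dirichlet_def mult_ac add_ac)

lemma dirichlet_shift_y:
  assumes "q > -1" "r > -1"
  shows "(q + 1) * dirichlet p q (r + 1) = (r + 1) * dirichlet p (q + 1) r"
  using dirichlet_shift_x[OF assms, of p] by (simp add: dirichlet_commute)

lemma poly_poly_eqI: "(\<And>i j. coeff (coeff f j) i = coeff (coeff g j) i) \<Longrightarrow> f = g"
  by (simp add: poly_eq_iff)

lemma euler_add:
  "euler_x (f + g) = euler_x f + euler_x g" "euler_y (f + g) = euler_y f + euler_y g"
  by (rule poly_poly_eqI, simp add: coeff_euler algebra_simps)+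

lemma euler_monom:
  "euler_x (monom (monom c i) j) = monom (monom (real i * c) i) j"
  "euler_y (monom (monom c i) j) = monom (monom (real j * c) i) j"
  by (rule poly_poly_eqI, simp add: coeff_euler)+

text \<open>Integration by parts in x, without boundary terms. Both sides are additive in g, and on
  a monomial with x-exponent i the claim is \<open>dirichlet_shift_x\<close> at p + i.\<close>

lemma moment_euler_x:
  assumes "p > -1" "q > -1" "r > -1"
  shows "moment p q (r + 1) (euler_x g) = (r + 1) * moment (p + 1) q r g - (p + 1) * moment p q (r + 1) g"
proof (induction g rule: bivariate_poly_induct)
  case (add f g)
  then show ?case
    using assms by (simp add: euler_add moment_add algebra_simps)
next
  case (monom c i j)
  have "(p + real i + 1) * dirichlet (p + real i) (q + real j) (r + 1)
      = (r + 1) * dirichlet (p + real i + 1) (q + real j) r"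
    using assms by (intro dirichlet_shift_x) auto
  from arg_cong[OF this, of "(*) c"] show ?case
    using assms by (simp add: euler_monom moment_monom algebra_simps)
qed

lemma moment_euler_y:
  assumes "p > -1" "q > -1" "r > -1"
  shows "moment p q (r + 1) (euler_y g) = (r + 1) * moment p (q + 1) r g - (q + 1) * moment p q (r + 1) g"
proof (induction g rule: bivariate_poly_induct)
  case (add f g)
  then show ?case
    using assms by (simp add: euler_add moment_add algebra_simps)
next
  case (monom c i j)
  have "(q + real j + 1) * dirichlet (p + real i) (q + real j) (r + 1)
      = (r + 1) * dirichlet (p + real i) (q + real j + 1) r"
    using assms by (intro dirichlet_shift_y) auto
  from arg_cong[OF this, of "(*) c"] show ?case
    using assms by (simp add: euler_monom moment_monom algebra_simps)
qed

text \<open>The term with \<open>moment (p + 1) q (r - 1) g\<close> from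
  \<open>moment_euler_x\<close> cancels against the \<open>var_x\<close> term of the step, so only a
  multiple of one moment survives. With r > 0 the lowered exponent stays above -1.\<close>

lemma moment_rodrigues_step_x:
  assumes "p > -1" "q > -1" "r > 0"
  shows "moment p q (r - 1) (rodrigues_step_x \<mu> r g) = (\<mu> - p - 1) * moment p q r g"
  using assms moment_euler_x[of p q "r - 1" g]
  by (simp add: rodrigues_step_x_def moment_diff moment_height_mult moment_add moment_const_mult
      moment_x_mult, simp add: algebra_simps)

lemma moment_rodrigues_step_y:
  assumes "p > -1" "q > -1" "r > 0"
  shows "moment p q (r - 1) (rodrigues_step_y \<nu> r g) = (\<nu> - q - 1) * moment p q r g"
  using assms moment_euler_y[of p q "r - 1" g]
  by (simp add: rodrigues_step_y_def moment_diff moment_height_mult moment_add moment_const_mult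
      moment_y_mult, simp add: algebra_simps)

lemma moment_rodrigues_steps_x:
  assumes "p > -1" "q > -1" "r - real i > -1"
  shows "moment p q (r - real i) (rodrigues_steps_x \<mu> r i g) = (\<Prod>j<i. \<mu> - real j - p - 1) * moment p q r g"
  using assms(3)
proof (induction i)
  \<comment> \<open>The bound r - (i + 1) > -1 says r - i > 0, which is what a single step
    requires.\<close>
  case (Suc i)
  then show ?case
    using assms(1,2) moment_rodrigues_step_x[of p q "r - real i" "\<mu> - real i" "rodrigues_steps_x \<mu> r i g"]
    by (simp add: mult_ac diff_diff_eq add_ac)
qed simp

lemma moment_rodrigues_steps_y:
  assumes "p > -1" "q > -1" "r - real i > -1"
  shows "moment p q (r - real i) (rodrigues_steps_y \<nu> r i g) = (\<Prod>j<i. \<nu> - real j - q - 1) * moment p q r g"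
  using assms(3)
proof (induction i)
  case (Suc i)
  then show ?case
    using assms(1,2) moment_rodrigues_step_y[of p q "r - real i" "\<nu> - real i" "rodrigues_steps_y \<nu> r i g"]
    by (simp add: mult_ac diff_diff_eq add_ac)
qed simp

lemma moment_rodrigues_poly:
  assumes "p > -1" "q > -1" "r > -1" "k \<le> n"
  shows "moment p q r (rodrigues_poly \<alpha> \<beta> (r + real n) n k g)
           = (\<Prod>j<n - k. \<alpha> + real (n - k) - real j - p - 1) *
             (\<Prod>j<k. \<beta> + real k - real j - q - 1) * moment p q (r + real n) g"
proof -
  \<comment> \<open>This presents r as the exponent left after k steps in y and n - k steps in x, so
    that the two chain lemmas apply in turn.\<close>
  have "r = r + real n - real k - real (n - k)"
    using assms by (simp add: of_nat_diff)
  then show ?thesis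
    unfolding rodrigues_poly_def
    using assms moment_rodrigues_steps_x[of p q "r + real n - real k" "n - k"]
      moment_rodrigues_steps_y[of p q "r + real n" k]
    by simp
qed

text \<open>The factor at \<open>j = a - Suc l\<close> is zero, and l < a puts this index in range.
  All vanishing Laurent coefficients come from here.\<close>

lemma rodrigues_factors_eq_0:
  fixes \<alpha> :: real
  assumes "l < a"
  shows "(\<Prod>j<a. \<alpha> + real a - real j - (\<alpha> + real l) - 1) = 0"
  using assms by (intro prod_zero bexI[of _ "a - Suc l"]) (auto simp: of_nat_diff)

section \<open>Series over pairs of indices\<close>

lemma has_sum_geometric_product:
  fixes u v :: "'a::{real_normed_field, banach}"
  assumes "norm u < 1" "norm v < 1"
  shows "((\<lambda>(l, m). u ^ l * v ^ m) has_sum (1 / ((1 - u) * (1 - v)))) UNIV"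
proof -
  have geo: "((\<lambda>i. s ^ i) has_sum (1 / (1 - s))) UNIV" if "norm s < 1"
    for s :: "'b::{real_normed_field, banach}"
    using that by (intro norm_summable_imp_has_sum geometric_sums) (simp add: norm_power)
  \<comment> \<open>For nonnegative terms convergence of the iterated sums gives summability;
    absolute summability then allows the original series to be summed iteratively.\<close>
  have "(\<lambda>(l, m). norm u ^ l * norm v ^ m) summable_on (SIGMA _:UNIV. UNIV)"
  proof (rule summable_on_SigmaI)
    show "((\<lambda>m. case (l, m) of (l, m) \<Rightarrow> norm u ^ l * norm v ^ m)
        has_sum (norm u ^ l * (1 / (1 - norm v)))) UNIV" for l
      unfolding prod.case using assms by (intro has_sum_cmult_right geo) simp
    show "(\<lambda>l. norm u ^ l * (1 / (1 - norm v))) summable_on UNIV"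
      by (rule has_sum_imp_summable[OF has_sum_cmult_left[OF geo]]) (use assms in simp)
  qed auto
  then have "(\<lambda>t. norm (case t of (l, m) \<Rightarrow> u ^ l * v ^ m)) summable_on (SIGMA _:UNIV. UNIV)"
    by (simp only: case_prod_unfold norm_mult norm_power)
  then have "(\<lambda>(l, m). u ^ l * v ^ m) summable_on (SIGMA _:UNIV. UNIV)"
    by (rule abs_summable_summable)
  then have "((\<lambda>(l, m). u ^ l * v ^ m) has_sum (1 / (1 - u) * (1 / (1 - v)))) (SIGMA _:UNIV. UNIV)"
  proof (rule has_sum_SigmaI[rotated 2])
    show "((\<lambda>m. case (l, m) of (l, m) \<Rightarrow> u ^ l * v ^ m) has_sum (u ^ l * (1 / (1 - v)))) UNIV" for l
      unfolding prod.case by (intro has_sum_cmult_right geo assms)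
    show "((\<lambda>l. u ^ l * (1 / (1 - v))) has_sum (1 / (1 - u) * (1 / (1 - v)))) UNIV"
      by (intro has_sum_cmult_left geo assms)
  qed
  then show ?thesis
    by simp
qed

text \<open>Termwise integration works with series over \<open>nat\<close>, the Laurent expansion
  with unordered sums over pairs. Absolute convergence makes the two agree along the enumeration
  \<open>prod_decode\<close>.\<close>

lemma sums_prod_decode_iff:
  fixes f :: "nat \<times> nat \<Rightarrow> 'a::banach"
  assumes "summable (\<lambda>i. norm (f (prod_decode i)))"
  shows "(\<lambda>i. f (prod_decode i)) sums s \<longleftrightarrow> (f has_sum s) UNIV"
proof -
  have "(\<lambda>i. f (prod_decode i)) sums s \<longleftrightarrow> ((\<lambda>i. f (prod_decode i)) has_sum s) UNIV"
    using norm_summable_imp_has_sum[OF assms] has_sum_imp_sums by metis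
  also have "\<dots> \<longleftrightarrow> (f has_sum s) UNIV"
    by (rule has_sum_reindex_bij_betw[OF bij_prod_decode])
  finally show ?thesis .
qed

section \<open>Laurent expansion of the remainder\<close>

lemma std_triangle_le_1:
  assumes "t \<in> std_triangle"
  shows "0 \<le> fst t" "fst t \<le> 1" "0 \<le> snd t" "snd t \<le> 1"
  using assms by (auto simp: std_triangle_def)

text \<open>Write z - x = z (1 - x/z) and likewise for w; both ratios have norm below 1.\<close>

lemma cauchy_kernel_has_sum:
  fixes z w :: complex and x y :: real
  assumes "norm z > 1" "norm w > 1" "\<bar>x\<bar> \<le> 1" "\<bar>y\<bar> \<le> 1"
  shows "((\<lambda>(l, m). of_real (x ^ l * y ^ m) / (z ^ (l + 1) * w ^ (m + 1)))
            has_sum (1 / ((z - of_real x) * (w - of_real y)))) UNIV"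
proof -
  have [simp]: "z \<noteq> 0" "w \<noteq> 0"
    using assms by auto
  have "norm (of_real x / z) < 1" "norm (of_real y / w) < 1"
    using assms by (auto simp: norm_divide)
  then have "((\<lambda>t. (1 / (z * w)) * (case t of (l, m) \<Rightarrow> (of_real x / z) ^ l * (of_real y / w) ^ m))
      has_sum ((1 / (z * w)) * (1 / ((1 - of_real x / z) * (1 - of_real y / w))))) UNIV"
    by (intro has_sum_cmult_right has_sum_geometric_product)
  also have "(1 / (z * w)) * (1 / ((1 - of_real x / z) * (1 - of_real y / w)))
      = 1 / ((z - of_real x) * (w - of_real y))"
    by (simp add: field_simps)
  also have "(\<lambda>t. (1 / (z * w)) * (case t of (l, m) \<Rightarrow> (of_real x / z) ^ l * (of_real y / w) ^ m))
      = (\<lambda>(l, m). of_real (x ^ l * y ^ m) / (z ^ (l + 1) * w ^ (m + 1)))"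
    by (auto simp: fun_eq_iff power_divide mult_ac)
  finally show ?thesis .
qed

lemma
  fixes F :: "real \<times> real \<Rightarrow> real" and z w :: complex
  assumes F: "set_integrable lborel std_triangle F" and z: "norm z > 1" and w: "norm w > 1"
  shows set_integrable_cauchy_kernel: "set_integrable lborel std_triangle
           (\<lambda>t. of_real (F t) / ((z - of_real (fst t)) * (w - of_real (snd t))))"
    and cauchy_transform_has_sum:
         "((\<lambda>(l, m). of_real (LINT t:std_triangle|lborel. F t * (fst t ^ l * snd t ^ m))
              / (z ^ (l + 1) * w ^ (m + 1)))
           has_sum (LINT t:std_triangle|lborel.
              of_real (F t) / ((z - of_real (fst t)) * (w - of_real (snd t))))) UNIV"
proof -
  let ?T = "\<lambda>t. indicator std_triangle t :: real"
  \<comment> \<open>On the triangle monomials are at most 1 in absolute value, so c dominates the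
    terms of the kernel expansion. The terms \<open>f p\<close> are then bounded by |F| times
    \<open>c p\<close>, and their integrals by \<open>K * c p\<close> with K the L1 norm of F on the
    triangle.\<close>
  define c where "c = (\<lambda>(l, m). norm (1 / (z ^ (l + 1) * w ^ (m + 1))))"
  define f where "f = (\<lambda>(l, m) t. ?T t *\<^sub>R
    (complex_of_real (F t) * (of_real (fst t ^ l * snd t ^ m) / (z ^ (l + 1) * w ^ (m + 1)))))"
  define s where "s = (\<lambda>t. ?T t *\<^sub>R
    (complex_of_real (F t) / ((z - of_real (fst t)) * (w - of_real (snd t)))))"
  define K where "K = (LINT t|lborel. \<bar>?T t * F t\<bar>)"
  have TF: "integrable lborel (\<lambda>t. ?T t * F t)"
    using F by (simp add: set_integrable_def)
  have c_nonneg: "c p \<ge> 0" for p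
    by (simp add: c_def case_prod_unfold)
  have f_le: "norm (f p t) \<le> \<bar>?T t * F t\<bar> * c p" for p t
  proof (cases "t \<in> std_triangle")
    case True
    obtain l m where p: "p = (l, m)" by force
    have "\<bar>fst t ^ l * snd t ^ m\<bar> \<le> 1"
      using std_triangle_le_1[OF True] by (simp add: abs_mult power_abs power_le_one mult_le_one)
    then have "\<bar>F t\<bar> * \<bar>fst t ^ l * snd t ^ m\<bar> * c p \<le> \<bar>F t\<bar> * 1 * c p"
      by (intro mult_left_mono mult_right_mono) (auto simp: c_def p)
    moreover have "norm (f p t) = \<bar>F t\<bar> * \<bar>fst t ^ l * snd t ^ m\<bar> * c p"
      using True by (simp add: f_def c_def p norm_mult norm_divide norm_power abs_mult power_abs)
    ultimately show ?thesis
      using True by simp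
  qed (simp add: f_def case_prod_unfold)
  have f_int: "integrable lborel (f p)" for p
  proof -
    obtain l m where p: "p = (l, m)" by force
    have eq: "f p t = complex_of_real (?T t * F t) *
        (of_real (fst t ^ l * snd t ^ m) / (z ^ (l + 1) * w ^ (m + 1)))" for t
      by (simp add: f_def p scaleR_conv_of_real)
    have "integrable lborel (\<lambda>t. \<bar>?T t * F t\<bar> * c p)"
      using TF by auto
    moreover have "f p \<in> borel_measurable lborel"
      unfolding eq[abs_def]
    proof (rule borel_measurable_times)
      show "(\<lambda>t. complex_of_real (?T t * F t)) \<in> borel_measurable lborel"
        by (rule measurable_compose[OF borel_measurable_integrable[OF TF]]) simp
    qed simp
    ultimately show ?thesis
      by (rule Bochner_Integration.integrable_bound) (use f_le c_nonneg in \<open>simp add: abs_mult\<close>)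
  qed
  have c_sum: "summable (\<lambda>i. c (prod_decode i))"
  proof -
    have "((\<lambda>t. (1 / (norm z * norm w)) * (case t of (l, m) \<Rightarrow> (1 / norm z) ^ l * (1 / norm w) ^ m))
        has_sum ((1 / (norm z * norm w)) * (1 / ((1 - 1 / norm z) * (1 - 1 / norm w))))) UNIV"
      using z w by (intro has_sum_cmult_right has_sum_geometric_product) (auto simp: divide_less_eq_1)
    moreover have "(\<lambda>t. (1 / (norm z * norm w)) * (case t of (l, m) \<Rightarrow> (1 / norm z) ^ l * (1 / norm w) ^ m)) = c"
      by (auto simp: c_def fun_eq_iff norm_divide norm_mult norm_power power_divide)
    ultimately have "c summable_on UNIV"
      using has_sum_imp_summable by metis
    then have "(\<lambda>i. c (prod_decode i)) summable_on UNIV"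
      using summable_on_reindex_bij_betw[OF bij_prod_decode] by blast
    then show ?thesis
      by (rule summable_on_imp_summable)
  qed
  have f_norm: "norm (LINT t|lborel. norm (f p t)) \<le> K * c p" for p
  proof -
    have "(LINT t|lborel. norm (f p t)) \<le> (LINT t|lborel. \<bar>?T t * F t\<bar> * c p)"
      using f_int TF by (intro integral_mono f_le) auto
    then show ?thesis
      by (simp add: K_def integral_nonneg_AE)
  qed
  have f_has_sum: "((\<lambda>p. f p t) has_sum s t) UNIV" for t
  proof (cases "t \<in> std_triangle")
    case True
    then show ?thesis
      using has_sum_cmult_right[OF cauchy_kernel_has_sum[OF z w, of "fst t" "snd t"],
          of "complex_of_real (F t)"] std_triangle_le_1[OF True]
      by (simp add: f_def s_def case_prod_unfold)
  qed (simp add: f_def s_def case_prod_unfold)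
  have norm_f: "summable (\<lambda>i. norm (f (prod_decode i) t))" for t
    by (rule summable_comparison_test'[OF summable_mult[OF c_sum, of "\<bar>?T t * F t\<bar>"]])
       (use f_le in simp)
  have suminf_f: "(\<Sum>i. f (prod_decode i) t) = s t" for t
    using sums_prod_decode_iff[of "\<lambda>p. f p t" "s t"] norm_f f_has_sum by (simp add: sums_iff)
  have norm_int: "summable (\<lambda>i. LINT t|lborel. norm (f (prod_decode i) t))"
    by (rule summable_comparison_test'[OF summable_mult[OF c_sum, of K]]) (use f_norm in simp)
  \<comment> \<open>These are the hypotheses for exchanging sum and integral: integrable terms,
    pointwise absolute convergence and summable L1 norms.\<close>
  note * = f_int AE_I2[OF norm_f] norm_int
  from integrable_suminf[OF *] show "set_integrable lborel std_triangle
      (\<lambda>t. of_real (F t) / ((z - of_real (fst t)) * (w - of_real (snd t))))"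
    by (simp add: suminf_f set_integrable_def s_def)
  have "summable (\<lambda>i. norm (integral\<^sup>L lborel (f (prod_decode i))))"
    by (rule summable_comparison_test'[OF norm_int]) simp
  with sums_integral[OF *] have "((\<lambda>p. integral\<^sup>L lborel (f p)) has_sum integral\<^sup>L lborel s) UNIV"
    using sums_prod_decode_iff[of "\<lambda>p. integral\<^sup>L lborel (f p)"] by (simp add: suminf_f)
  also have "(\<lambda>p. integral\<^sup>L lborel (f p)) = (\<lambda>(l, m).
      of_real (LINT t:std_triangle|lborel. F t * (fst t ^ l * snd t ^ m)) / (z ^ (l + 1) * w ^ (m + 1)))"
  proof (intro ext, clarify)
    fix l m
    have "integral\<^sup>L lborel (f (l, m)) = (LINT t:std_triangle|lborel.
        complex_of_real (F t * (fst t ^ l * snd t ^ m)) / (z ^ (l + 1) * w ^ (m + 1)))"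
      by (simp only: f_def set_lebesgue_integral_def prod.case of_real_mult times_divide_eq_right)
    also have "\<dots> = of_real (LINT t:std_triangle|lborel. F t * (fst t ^ l * snd t ^ m))
        / (z ^ (l + 1) * w ^ (m + 1))"
      by (simp only: set_integral_divide_zero set_integral_complex_of_real)
    finally show "integral\<^sup>L lborel (f (l, m)) =
        of_real (LINT t:std_triangle|lborel. F t * (fst t ^ l * snd t ^ m))
        / (z ^ (l + 1) * w ^ (m + 1))" .
  qed
  finally show "((\<lambda>(l, m). of_real (LINT t:std_triangle|lborel. F t * (fst t ^ l * snd t ^ m))
              / (z ^ (l + 1) * w ^ (m + 1)))
           has_sum (LINT t:std_triangle|lborel.
              of_real (F t) / ((z - of_real (fst t)) * (w - of_real (snd t))))) UNIV"
    by (simp add: s_def set_lebesgue_integral_def)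
qed

text \<open>Splitting the integral of \<open>phi_fun\<close>, the part with A(z, w) cancels the
  product of A and the Stieltjes transform. What remains is the Cauchy transform of A times the
  weight, whose Laurent coefficients are moments.\<close>

lemma remainder_has_sum:
  fixes z w :: complex
  assumes "p > -1" "q > -1" "r > -1" and z: "norm z > 1" and w: "norm w > 1"
  shows "((\<lambda>(l, m). of_real (moment (p + real l) (q + real m) r A) / (z ^ (l + 1) * w ^ (m + 1)))
            has_sum (eval2 A z w * stieltjes p q r z w - phi_fun A p q r z w)) UNIV"
proof -
  let ?W = "\<lambda>t. weight p q r (fst t) (snd t)"
  let ?A = "\<lambda>t. eval2 A (fst t) (snd t) :: real"
  let ?k = "\<lambda>t. (z - complex_of_real (fst t)) * (w - complex_of_real (snd t))"
  note W = set_integrable_weight[OF assms(1-3)]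
  note WA = set_integrable_weight_eval2[OF assms(1-3), of A]
  have "phi_fun A p q r z w = (LINT t:std_triangle|lborel.
      eval2 A z w * (of_real (?W t) / ?k t) - of_real (?W t * ?A t) / ?k t)"
    unfolding phi_fun_def case_prod_unfold
    by (intro set_lebesgue_integral_cong) (auto simp: diff_divide_distrib algebra_simps)
  also have "\<dots> = (LINT t:std_triangle|lborel. eval2 A z w * (of_real (?W t) / ?k t))
      - (LINT t:std_triangle|lborel. of_real (?W t * ?A t) / ?k t)"
    \<comment> \<open>The split is legitimate because the weight and the weight times A are both
      integrable, hence so are their products with the kernel.\<close>
    by (intro set_integral_diff set_integrable_mult_right set_integrable_cauchy_kernel W WA z w)
  also have "(LINT t:std_triangle|lborel. eval2 A z w * (of_real (?W t) / ?k t))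
      = eval2 A z w * stieltjes p q r z w"
    by (simp only: set_integral_mult_right stieltjes_def case_prod_unfold)
  finally have "eval2 A z w * stieltjes p q r z w - phi_fun A p q r z w
      = (LINT t:std_triangle|lborel. of_real (?W t * ?A t) / ?k t)"
    by simp
  moreover have "(LINT t:std_triangle|lborel. ?W t * ?A t * (fst t ^ l * snd t ^ m))
      = moment (p + real l) (q + real m) r A" for l m
    unfolding moment_def
  proof (intro set_lebesgue_integral_cong allI impI)
    fix t assume "t \<in> std_triangle"
    then show "?W t * ?A t * (fst t ^ l * snd t ^ m)
        = weight (p + real l) (q + real m) r (fst t) (snd t) * ?A t"
      using weight_mult_monomial[of "fst t" "snd t" p q r l m] by (simp add: mult_ac)
  qed simp
  ultimately show ?thesis
    using cauchy_transform_has_sum[OF WA z w] by simp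
qed

lemma bigO_laurent_remainder:
  assumes "p > -1" "q > -1" "r > -1"
    and "\<And>l m. l < a \<or> m < b \<Longrightarrow> moment (p + real l) (q + real m) r A = 0"
  shows "bigO_laurent (\<lambda>z w. eval2 A z w * stieltjes p q r z w - phi_fun A p q r z w) a b"
  unfolding bigO_laurent_def
proof (intro exI conjI)
  let ?b = "\<lambda>l m. complex_of_real (moment (p + real l) (q + real m) r A)"
  \<comment> \<open>The expansion is valid for |z|, |w| > 1, since the triangle lies in the unit
    square.\<close>
  have 1: "\<forall>\<^sub>F z in at_infinity. norm (z :: complex) > 1"
    by (rule eventually_at_infinityI[of 2]) auto
  show "\<forall>\<^sub>F (z, w) in at_infinity \<times>\<^sub>F at_infinity.
      ((\<lambda>(l, m). ?b l m / (z ^ (l + 1) * w ^ (m + 1))) has_sum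
        eval2 A z w * stieltjes p q r z w - phi_fun A p q r z w) UNIV"
    using eventually_prodI[OF 1 1]
    by (rule eventually_mono) (clarify, intro remainder_has_sum assms(1-3), simp_all)
  show "\<forall>l m. l < a \<or> m < b \<longrightarrow> ?b l m = 0"
    using assms(4) by auto
qed

section \<open>The Hermite-Pade property of the Rodrigues polynomial\<close>

theorem proposition4p1:
  fixes \<alpha> \<beta> :: "nat \<Rightarrow> real" and \<gamma> :: real and n k :: "nat \<Rightarrow> nat"
  assumes "\<alpha> 1 > -1" and "\<alpha> 2 > -1" and "\<beta> 1 > -1" and "\<beta> 2 > -1" and "\<gamma> > -1"
    and "(\<alpha> 1, \<beta> 1) \<noteq> (\<alpha> 2, \<beta> 2)"
    and "k 1 \<le> n 1" and "k 2 \<le> n 2"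
  defines "A \<equiv> U_poly \<alpha> \<beta> \<gamma> n k"
  shows "(\<forall>(x, y) \<in> interior std_triangle. eval2 A x y = rodrigues_fun \<alpha> \<beta> \<gamma> n k x y) \<and>
         total_degree_le A (n 1 + n 2) \<and>
         (\<forall>j \<in> {1, 2}.
            bigO_laurent
              (\<lambda>z w. eval2 A z w * stieltjes (\<alpha> j) (\<beta> j) \<gamma> z w
                       - phi_fun A (\<alpha> j) (\<beta> j) \<gamma> z w)
              (n j - k j) (k j))"
proof -
  \<comment> \<open>The first operator acts on h^(n 1 + n 2) times 1 and leaves h^(n 2) times P1;
    the second uses up the remaining powers of h and leaves P.\<close>
  define P1 where "P1 = rodrigues_poly (\<alpha> 1) (\<beta> 1) (\<gamma> + real (n 1 + n 2)) (n 1) (k 1) 1"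
  define P where "P = rodrigues_poly (\<alpha> 2) (\<beta> 2) (\<gamma> + real (n 2)) (n 2) (k 2) P1"
  have eq: "rodrigues_fun \<alpha> \<beta> \<gamma> n k x y = eval2 P x y" if xy: "(x, y) \<in> interior std_triangle" for x y
  proof -
    define f where "f = rodrigues_op (\<alpha> 1) (\<beta> 1) \<gamma> (n 1) (k 1) (\<lambda>x y. (1 - x - y) ^ (n 1 + n 2))"
    have "f x y = (1 - x - y) ^ n 2 * eval2 P1 x y" if "(x, y) \<in> interior std_triangle" for x y
      unfolding f_def P1_def
      using rodrigues_op_eq_rodrigues_poly[where s = "n 1 + n 2" and g = 1 and n = "n 1" and k = "k 1"]
        assms(7) that by (simp add: eval2_def)
    then show ?thesis
      using rodrigues_op_eq_rodrigues_poly[where f = f and s = "n 2" and g = P1 and n = "n 2" and k = "k 2"]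
        assms(8) xy unfolding rodrigues_fun_def o_apply f_def[symmetric] P_def by simp
  qed
  have A: "A = P"
    unfolding A_def U_poly_def
  proof (rule the_equality)
    show "\<forall>(x, y) \<in> interior std_triangle. eval2 P x y = rodrigues_fun \<alpha> \<beta> \<gamma> n k x y"
      using eq by auto
    fix Q assume Q: "\<forall>(x, y) \<in> interior std_triangle. eval2 Q x y = rodrigues_fun \<alpha> \<beta> \<gamma> n k x y"
    show "Q = P"
    \<comment> \<open>The open square of side 1/2 at the origin lies in the interior of the
      triangle.\<close>
    proof (rule eval2_eqI[of 0 "1/2" 0 "1/2"])
      fix x y :: real assume "x \<in> {0<..<1/2}" "y \<in> {0<..<1/2}"
      then have "(x, y) \<in> interior std_triangle"
        by (auto simp: interior_std_triangle)
      with Q eq show "eval2 Q x y = eval2 P x y"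
        by auto
    qed auto
  qed
  \<comment> \<open>The scalar factors of both operators appear in the same moment, so the operator
    applied first contributes zeros just as the one applied last. This gives the conditions for j =
    1 and j = 2 together.\<close>
  have moment_P: "moment p q \<gamma> P =
      (\<Prod>j<n 2 - k 2. \<alpha> 2 + real (n 2 - k 2) - real j - p - 1) *
      (\<Prod>j<k 2. \<beta> 2 + real (k 2) - real j - q - 1) *
      ((\<Prod>j<n 1 - k 1. \<alpha> 1 + real (n 1 - k 1) - real j - p - 1) *
      (\<Prod>j<k 1. \<beta> 1 + real (k 1) - real j - q - 1) * moment p q (\<gamma> + real (n 1 + n 2)) 1)"
    if "p > -1" "q > -1" for p q
  proof -
    have "moment p q \<gamma> P = (\<Prod>j<n 2 - k 2. \<alpha> 2 + real (n 2 - k 2) - real j - p - 1) *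
        (\<Prod>j<k 2. \<beta> 2 + real (k 2) - real j - q - 1) * moment p q (\<gamma> + real (n 2)) P1"
      unfolding P_def using assms by (intro moment_rodrigues_poly that)
    moreover have shift: "\<gamma> + real (n 1 + n 2) = \<gamma> + real (n 2) + real (n 1)"
      by simp
    have "moment p q (\<gamma> + real (n 2)) P1 =
        (\<Prod>j<n 1 - k 1. \<alpha> 1 + real (n 1 - k 1) - real j - p - 1) *
        (\<Prod>j<k 1. \<beta> 1 + real (k 1) - real j - q - 1) * moment p q (\<gamma> + real (n 1 + n 2)) 1"
      unfolding P1_def shift using assms by (intro moment_rodrigues_poly that) auto
    ultimately show ?thesis
      by (simp only:)
  qed
  have "total_degree_le (1 :: real poly poly) 0"
    by (auto simp: total_degree_le_def coeff_1 split: if_splits)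
  then have "total_degree_le P (n 1 + n 2)"
    unfolding P_def P1_def using total_degree_le_rodrigues_poly assms(7,8) by (metis add_0)
  moreover have "bigO_laurent (\<lambda>z w. eval2 P z w * stieltjes (\<alpha> j) (\<beta> j) \<gamma> z w
      - phi_fun P (\<alpha> j) (\<beta> j) \<gamma> z w) (n j - k j) (k j)" if j: "j \<in> {1, 2}" for j
  proof (rule bigO_laurent_remainder)
    show "\<alpha> j > -1" "\<beta> j > -1" "\<gamma> > -1"
      using j assms by auto
    fix l m assume "l < n j - k j \<or> m < k j"
    \<comment> \<open>If l < n j - k j the x-product of the j-th operator vanishes, if m < k j its
      y-product does; either one makes the whole moment zero.\<close>
    with j assms(1-5) show "moment (\<alpha> j + real l) (\<beta> j + real m) \<gamma> P = 0"
      using rodrigues_factors_eq_0[of l "n j - k j" "\<alpha> j"] rodrigues_factors_eq_0[of m "k j" "\<beta> j"]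
      by (auto simp: moment_P)
  qed
  ultimately show ?thesis
    using eq by (auto simp: A)
qed

end
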